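(* Let $\mathsf{A}=a_0+\mathbf{a}+\mathcal{A}+a_{123}I$ be a multivector in the real Clifford algebra $\mathit{Cl}_{3,0}$ or $\mathit{Cl}_{1,2}$, with vector part $\mathbf{a}=a_1\mathbf{e}_1+a_2\mathbf{e}_2+a_3\mathbf{e}_3$, bivector part $\mathcal{A}=a_{12}\mathbf{e}_{12}+a_{13}\mathbf{e}_{13}+a_{23}\mathbf{e}_{23}$, real coefficients and $I=\mathbf{e}_{123}$. Define real scalars $a_+,a_-$ as follows. If $\mathbf{a}\wedge\mathcal{A}\neq0$, $$a_-=\frac{-2I\,\mathbf{a}\wedge\mathcal{A}}{\sqrt2\,\sqrt{\mathbf{a}\cdot\mathbf{a}+\mathcal{A}\cdot\mathcal{A}+\sqrt{(\mathbf{a}\cdot\mathbf{a}+\mathcal{A}\cdot\mathcal{A})^2-4(\mathbf{a}\wedge\mathcal{A})^2}}},$$ $$a_+=\frac{\sqrt{\mathbf{a}\cdot\mathbf{a}+\mathcal{A}\cdot\mathcal{A}+\sqrt{(\mathbf{a}\cdot\mathbf{a}+\mathcal{A}\cdot\mathcal{A})^2-4(\mathbf{a}\wedge\mathcal{A})^2}}}{\sqrt2};$$ if $\mathbf{a}\wedge\mathcal{A}=0$, then $$\begin{cases}a_+=\sqrt{\mathbf{a}\cdot\mathbf{a}+\mathcal{A}\cdot\mathcal{A}},\quad a_-=0,&\text{if }\mathbf{a}\cdot\mathbf{a}+\mathcal{A}\cdot\mathcal{A}\ge0,\\ a_+=0,\quad a_-=\sqrt{-(\mathbf{a}\cdot\mathbf{a}+\mathcal{A}\cdot\mathcal{A})},&\text{if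 }\mathbf{a}\cdot\mathbf{a}+\mathcal{A}\cdot\mathcal{A}<0.\end{cases}$$ Let $k_\pm\ge0$ be given by $$k_-^2=(a_+-a_0)^2+(a_--a_{123})^2,\qquad k_+^2=(a_++a_0)^2+(a_-+a_{123})^2.$$ Suppose that $\mathsf{A}$ is generic, meaning that $a_+^2+a_-^2\neq0$, that $k_-k_+\neq0$, and that at least one of $(a_++a_0)k_--(a_+-a_0)k_+\neq0$ and $(a_-+a_{123})k_--(a_--a_{123})k_+\neq0$ holds. Then for arbitrary integers $c_1,c_2$ the multivector $$\log(\mathsf{A})=\mathsf{A}_0+\mathsf{A}_{{1,2}_{\log}}+\mathsf{A}_{{1,2}_{\arctan}}+\mathsf{A}_I,$$ where $$\mathsf{A}_0=\tfrac12(\log k_++\log k_-),\qquad \mathsf{A}_{{1,2}_{\log}}=\frac12\,\frac{a_+-a_-I}{a_-^2+a_+^2}\,(\log k_+-\log k_-)\,(\mathbf{a}+\mathcal{A}),$$ $$\mathsf{A}_{{1,2}_{\arctan}}=-I\,\frac{a_+-a_-I}{a_-^2+a_+^2}\,(\mathbf{a}+\mathcal{A})\Bigl(\tfrac12\arctan\bigl(-(a_+^2-a_0^2)-(a_-^2-a_{123}^2),\;(a_+-a_0)(a_-+a_{123})-(a_++a_0)(a_--a_{123})\bigr)+2\pi c_1\Bigr),$$ $$\mathsf{A}_I=I\arctan\bigl((a_++a_0)k_--(a_+-a_0)k_+,\;(a_-+a_{123})k_--(a_--a_{123})k_+\bigr)+2\pi c_2I,$$ is a logarithm of $\mathsf{A}$,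 i.e. $\exp(\log(\mathsf{A}))=\mathsf{A}$.
   Context: $\mathit{Cl}_{p,q}$ with $p+q=3$ is the real associative unital algebra generated by $\mathbf{e}_1,\mathbf{e}_2,\mathbf{e}_3$ with $\mathbf{e}_i\mathbf{e}_j=-\mathbf{e}_j\mathbf{e}_i$ for $i\neq j$, where $\mathbf{e}_1^2=\mathbf{e}_2^2=\mathbf{e}_3^2=1$ for $\mathit{Cl}_{3,0}$, and $\mathbf{e}_1^2=1$, $\mathbf{e}_2^2=\mathbf{e}_3^2=-1$ for $\mathit{Cl}_{1,2}$. Its basis is $1,\mathbf{e}_1,\mathbf{e}_2,\mathbf{e}_3,\mathbf{e}_{12},\mathbf{e}_{13},\mathbf{e}_{23},\mathbf{e}_{123}=I$, with $\mathbf{e}_{ij}=\mathbf{e}_i\mathbf{e}_j$ and $\mathbf{e}_{123}=\mathbf{e}_1\mathbf{e}_2\mathbf{e}_3$. A multivector is any element of the algebra. For a vector $\mathbf{a}$ and a bivector $\mathcal{A}$, $\mathbf{a}\cdot\mathbf{a}$ and $\mathcal{A}\cdot\mathcal{A}$ denote the scalars $\mathbf{a}^2$ and $\mathcal{A}^2$, and $\mathbf{a}\wedge\mathcal{A}$ is the grade-3 (pseudoscalar) part of the product $\mathbf{a}\mathcal{A}$, so that $I\,\mathbf{a}\wedge\mathcal{A}$ and $(\mathbf{a}\wedge\mathcal{A})^2$ are real scalars. The exponential is $\exp(\mathsf{M})=\sum_{k\ge0}\mathsf{M}^k/k!$. A logarithm of $\mathsf{A}$ is a multivector $\mathsf{L}$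 of the same algebra with $\exp(\mathsf{L})=\mathsf{A}$ (the logarithm is multivalued). The logarithm of a positive real number is the usual real one. The two-argument arc tangent $\arctan(x,y)$, for real $(x,y)\neq(0,0)$, with the argument order of Mathematica, is the angle $\theta\in(-\pi,\pi]$ with $\cos\theta=x/\sqrt{x^2+y^2}$ and $\sin\theta=y/\sqrt{x^2+y^2}$. *)

theory Defs
  imports Complex_Main
begin

section \<open>The real Clifford algebras Cl(p,q)\<close>

text \<open>The signature is carried by a phantom type, so that each Cl(p,q) is a type of its own and the
  library's \<^const>\<open>exp\<close> applies to it.\<close>

class signature =
  fixes pos_dim :: "'a itself \<Rightarrow> nat"
    and neg_dim :: "'a itself \<Rightarrow> nat"

datatype sig30 = Sig30
datatype sig12 = Sig12

instantiation sig30 :: signature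
begin
definition "pos_dim_sig30 = (\<lambda>_ :: sig30 itself. 3 :: nat)"
definition "neg_dim_sig30 = (\<lambda>_ :: sig30 itself. 0 :: nat)"
instance ..
end

instantiation sig12 :: signature
begin
definition "pos_dim_sig12 = (\<lambda>_ :: sig12 itself. 1 :: nat)"
definition "neg_dim_sig12 = (\<lambda>_ :: sig12 itself. 2 :: nat)"
instance ..
end

lemma signature_simps [simp]:
  "pos_dim TYPE(sig30) = 3" "neg_dim TYPE(sig30) = 0"
  "pos_dim TYPE(sig12) = 1" "neg_dim TYPE(sig12) = 2"
  by (simp_all add: pos_dim_sig30_def neg_dim_sig30_def pos_dim_sig12_def neg_dim_sig12_def)

definition gens :: "'s::signature itself \<Rightarrow> nat set" where
  "gens s = {1..pos_dim s + neg_dim s}"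

definition gen_sq :: "'s::signature itself \<Rightarrow> nat \<Rightarrow> real" where
  "gen_sq s i = (if i \<le> pos_dim s then 1 else -1)"

text \<open>For \<open>S = {i\<^sub>1 < \<dots> < i\<^sub>k}\<close> the basis blade of \<open>S\<close> is \<open>e\<^bsub>i\<^sub>1\<^esub> \<cdots> e\<^bsub>i\<^sub>k\<^esub>\<close>.
  Sorting the product of the blades of \<open>S\<close> and \<open>T\<close> costs one sign for every pair
  \<open>i \<in> S\<close>, \<open>j \<in> T\<close> with \<open>j < i\<close> and one factor \<open>e\<^sub>i\<^sup>2\<close> for every \<open>i \<in> S \<inter> T\<close>;
  what remains is the blade of the symmetric difference of \<open>S\<close> and \<open>T\<close>.\<close>

definition gen_swap :: "'s::signature itself \<Rightarrow> nat \<Rightarrow> nat \<Rightarrow> real" where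
  "gen_swap s i j = (if j < i then -1 else if i = j then gen_sq s i else 1)"

definition blade_sign :: "'s::signature itself \<Rightarrow> nat set \<Rightarrow> nat set \<Rightarrow> real" where
  "blade_sign s S T = (\<Prod>i\<in>S. \<Prod>j\<in>T. gen_swap s i j)"

definition symd :: "nat set \<Rightarrow> nat set \<Rightarrow> nat set" where
  "symd S T = sym_diff S T"

typedef (overloaded) 's clifford =
  "{f :: nat set \<Rightarrow> real. \<forall>S. \<not> S \<subseteq> gens TYPE('s::signature) \<longrightarrow> f S = 0}"
  morphisms coef Abs_clifford
  by (rule exI[of _ "\<lambda>_. 0"]) simp

setup_lifting type_definition_clifford

lemma coef_outside: "\<not> S \<subseteq> gens TYPE('s::signature) \<Longrightarrow> coef (x :: 's clifford) S = 0"
  using coef[of x] by auto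

lemma clifford_eqI:
  "(\<And>S. S \<subseteq> gens TYPE('s::signature) \<Longrightarrow> coef x S = coef y S) \<Longrightarrow> x = (y :: 's clifford)"
  by (metis coef_inject coef_outside ext)

lemma finite_gens [simp]: "finite (gens s)"
  by (simp add: gens_def)

lemma finite_sub_gens: "S \<subseteq> gens s \<Longrightarrow> finite S"
  using finite_gens finite_subset by blast

lemma symd_sub_gens [simp]:
  "R \<subseteq> gens s \<Longrightarrow> symd R S \<subseteq> gens s \<longleftrightarrow> S \<subseteq> gens s"
  by (auto simp: symd_def)

lemma symd_assoc: "symd (symd R S) T = symd R (symd S T)"
  by (auto simp: symd_def)

lemma symd_cancel [simp]: "symd R (symd R S) = S"
  by (auto simp: symd_def)

lemma symd_commute: "symd R S = symd S R"
  by (auto simp: symd_def)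

lemma symd_empty [simp]: "symd {} S = S" "symd S {} = S" "symd S S = {}"
  by (auto simp: symd_def)

lemma bij_betw_symd: "R \<subseteq> gens s \<Longrightarrow> bij_betw (symd R) (Pow (gens s)) (Pow (gens s))"
  by (rule bij_betw_byWitness[where f' = "symd R"]) (auto simp: symd_def)

lemma prod_symd:
  fixes f :: "nat \<Rightarrow> real"
  assumes "finite S" "finite T" "\<And>i. f i * f i = 1"
  shows "prod f (symd S T) = prod f S * prod f T"
proof -
  have S: "prod f S = prod f (S - T) * prod f (S \<inter> T)"
    using assms(1) by (metis Diff_Diff_Int Diff_subset mult.commute prod.subset_diff)
  have T: "prod f T = prod f (T - S) * prod f (S \<inter> T)"
    using assms(2) by (metis Diff_Diff_Int Diff_subset Int_commute mult.commute prod.subset_diff)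
  have "prod f (S \<inter> T) * prod f (S \<inter> T) = 1"
    by (simp add: prod.distrib[symmetric] assms(3))
  moreover have "prod f (symd S T) = prod f (S - T) * prod f (T - S)"
    unfolding symd_def using assms by (intro prod.union_disjoint) auto
  ultimately show ?thesis
    unfolding S T by (simp add: algebra_simps)
qed

lemma gen_swap_sq: "gen_swap s i j * gen_swap s i j = 1"
  by (simp add: gen_swap_def gen_sq_def)

lemma blade_sign_left:
  assumes "finite R" "finite S"
  shows "blade_sign s (symd R S) T = blade_sign s R T * blade_sign s S T"
  unfolding blade_sign_def
  by (rule prod_symd[OF assms]) (simp add: prod.distrib[symmetric] gen_swap_sq)

lemma blade_sign_right:
  assumes "finite S" "finite T"
  shows "blade_sign s R (symd S T) = blade_sign s R S * blade_sign s R T"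
  unfolding blade_sign_def
  by (simp add: prod_symd[OF assms] gen_swap_sq prod.distrib)

lemma abs_blade_sign [simp]: "\<bar>blade_sign s S T\<bar> = 1"
proof -
  have "\<bar>gen_swap s i j\<bar> = 1" for i j
    by (simp add: gen_swap_def gen_sq_def)
  then show ?thesis
    by (simp add: blade_sign_def abs_prod)
qed

instantiation clifford :: (signature) ring_1
begin

lift_definition zero_clifford :: "'a clifford" is "\<lambda>_. 0" by simp

lift_definition one_clifford :: "'a clifford" is "\<lambda>S. if S = {} then 1 else 0" by auto

lift_definition plus_clifford :: "'a clifford \<Rightarrow> 'a clifford \<Rightarrow> 'a clifford"
  is "\<lambda>x y S. x S + y S" by simp

lift_definition minus_clifford :: "'a clifford \<Rightarrow> 'a clifford \<Rightarrow> 'a clifford"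
  is "\<lambda>x y S. x S - y S" by simp

lift_definition uminus_clifford :: "'a clifford \<Rightarrow> 'a clifford"
  is "\<lambda>x S. - x S" by simp

lift_definition times_clifford :: "'a clifford \<Rightarrow> 'a clifford \<Rightarrow> 'a clifford"
  is "\<lambda>x y S. \<Sum>T\<in>Pow (gens TYPE('a)). blade_sign TYPE('a) T (symd T S) * x T * y (symd T S)"
  by (auto intro!: sum.neutral)

instance
proof
  fix x y z :: "'a clifford"
  let ?G = "Pow (gens TYPE('a))" and ?s = "blade_sign TYPE('a)"
  show "x * y * z = x * (y * z)"
  proof (rule clifford_eqI)
    fix S assume S: "S \<subseteq> gens TYPE('a)"
    have "coef (x * y * z) S = (\<Sum>T\<in>?G. \<Sum>R\<in>?G.
        ?s T (symd T S) * (?s R (symd R T) * coef x R * coef y (symd R T)) * coef z (symd T S))"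
      by (simp add: times_clifford.rep_eq sum_distrib_left sum_distrib_right)
    also have "\<dots> = (\<Sum>R\<in>?G. \<Sum>T\<in>?G.
        ?s T (symd T S) * (?s R (symd R T) * coef x R * coef y (symd R T)) * coef z (symd T S))"
      by (rule sum.swap)
    also have "\<dots> = (\<Sum>R\<in>?G. \<Sum>U\<in>?G.
        ?s R (symd R S) * coef x R * (?s U (symd U (symd R S)) * coef y U * coef z (symd U (symd R S))))"
    proof (rule sum.cong[OF refl])
      fix R assume R: "R \<in> ?G"
      have "(\<Sum>U\<in>?G. ?s R (symd R S) * coef x R *
              (?s U (symd U (symd R S)) * coef y U * coef z (symd U (symd R S)))) =
            (\<Sum>T\<in>?G. ?s R (symd R S) * coef x R * (?s (symd R T) (symd (symd R T) (symd R S)) *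
              coef y (symd R T) * coef z (symd (symd R T) (symd R S))))"
        by (rule sum.reindex_bij_betw[symmetric]) (use R in \<open>auto intro: bij_betw_symd\<close>)
      also have "\<dots> = (\<Sum>T\<in>?G.
        ?s T (symd T S) * (?s R (symd R T) * coef x R * coef y (symd R T)) * coef z (symd T S))"
      proof (rule sum.cong[OF refl])
        fix T assume T: "T \<in> ?G"
        have fin: "finite R" "finite T" "finite S" "finite (symd R T)" "finite (symd T S)"
          by (rule finite_sub_gens[where s = "TYPE('a)"]; use R S T in simp)+
        have 1: "symd (symd R T) (symd R S) = symd T S"
          by (auto simp: symd_def)
        have 2: "?s R (symd R S) = ?s R (symd R T) * ?s R (symd T S)"
          using blade_sign_right[OF fin(4,5), of "TYPE('a)" R]
          by (simp add: symd_assoc)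
        have 3: "?s T (symd T S) = ?s R (symd T S) * ?s (symd R T) (symd T S)"
          using blade_sign_left[OF fin(1,4), of "TYPE('a)" "symd T S"] by simp
        show "?s R (symd R S) * coef x R * (?s (symd R T) (symd (symd R T) (symd R S)) *
              coef y (symd R T) * coef z (symd (symd R T) (symd R S))) =
          ?s T (symd T S) * (?s R (symd R T) * coef x R * coef y (symd R T)) * coef z (symd T S)"
          unfolding 1 2 3 by (simp add: mult_ac)
      qed
      finally show "(\<Sum>T\<in>?G.
        ?s T (symd T S) * (?s R (symd R T) * coef x R * coef y (symd R T)) * coef z (symd T S)) =
        (\<Sum>U\<in>?G. ?s R (symd R S) * coef x R *
              (?s U (symd U (symd R S)) * coef y U * coef z (symd U (symd R S))))" ..
    qed
    also have "\<dots> = coef (x * (y * z)) S"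
      by (simp add: times_clifford.rep_eq sum_distrib_left)
    finally show "coef (x * y * z) S = coef (x * (y * z)) S" .
  qed
  show "1 * x = x"
  proof (rule clifford_eqI)
    fix S assume "S \<subseteq> gens TYPE('a)"
    have "coef (1 * x) S = (\<Sum>T\<in>?G. if T = {} then coef x S else 0)"
      unfolding times_clifford.rep_eq one_clifford.rep_eq
      by (rule sum.cong) (auto simp: blade_sign_def)
    then show "coef (1 * x) S = coef x S" by (simp add: sum.delta)
  qed
  show "x * 1 = x"
  proof (rule clifford_eqI)
    fix S assume S: "S \<subseteq> gens TYPE('a)"
    have "symd T S = {} \<longleftrightarrow> T = S" for T
      by (auto simp: symd_def)
    then have "coef (x * 1) S = (\<Sum>T\<in>?G. if T = S then coef x S else 0)"
      unfolding times_clifford.rep_eq one_clifford.rep_eq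
      by (intro sum.cong) (auto simp: blade_sign_def)
    then show "coef (x * 1) S = coef x S" using S by (simp add: sum.delta)
  qed
  have "coef (0 :: 'a clifford) {} \<noteq> coef (1 :: 'a clifford) {}"
    by (simp add: zero_clifford.rep_eq one_clifford.rep_eq)
  then show "(0 :: 'a clifford) \<noteq> 1" by metis
qed (rule clifford_eqI; simp add: plus_clifford.rep_eq minus_clifford.rep_eq uminus_clifford.rep_eq
      zero_clifford.rep_eq times_clifford.rep_eq algebra_simps sum.distrib)+

end

text \<open>The algebra is finite-dimensional, so \<^const>\<open>exp\<close> does not depend on the choice of norm;
  the sum of the absolute values of the coefficients is submultiplicative.\<close>

instantiation clifford :: (signature) real_normed_algebra_1
begin

lift_definition scaleR_clifford :: "real \<Rightarrow> 'a clifford \<Rightarrow> 'a clifford"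
  is "\<lambda>r x S. r * x S" by simp

definition norm_clifford :: "'a clifford \<Rightarrow> real" where
  "norm_clifford x = (\<Sum>S\<in>Pow (gens TYPE('a)). \<bar>coef x S\<bar>)"

definition dist_clifford :: "'a clifford \<Rightarrow> 'a clifford \<Rightarrow> real" where
  "dist_clifford x y = norm (x - y)"

definition sgn_clifford :: "'a clifford \<Rightarrow> 'a clifford" where
  "sgn_clifford x = scaleR (inverse (norm x)) x"

definition uniformity_clifford :: "('a clifford \<times> 'a clifford) filter" where
  "uniformity_clifford = (INF e\<in>{0<..}. principal {(x, y). dist x y < e})"

definition open_clifford :: "'a clifford set \<Rightarrow> bool" where
  "open_clifford U \<longleftrightarrow>
    (\<forall>x\<in>U. eventually (\<lambda>(x', y). x' = x \<longrightarrow> y \<in> U) uniformity)"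

instance
proof
  fix x y :: "'a clifford" and r :: real
  let ?G = "Pow (gens TYPE('a))"
  show "norm x = 0 \<longleftrightarrow> x = 0"
  proof
    assume "norm x = 0"
    then have "\<forall>S\<in>?G. coef x S = 0"
      by (simp add: norm_clifford_def sum_nonneg_eq_0_iff)
    then show "x = 0"
      by (intro clifford_eqI) (simp add: zero_clifford.rep_eq)
  qed (simp add: norm_clifford_def zero_clifford.rep_eq)
  show "norm (x + y) \<le> norm x + norm y"
    by (simp add: norm_clifford_def plus_clifford.rep_eq sum.distrib[symmetric] sum_mono)
  show "norm (r *\<^sub>R x) = \<bar>r\<bar> * norm x"
    by (simp add: norm_clifford_def scaleR_clifford.rep_eq abs_mult sum_distrib_left)
  show "norm (1 :: 'a clifford) = 1"
    by (simp add: norm_clifford_def one_clifford.rep_eq if_distrib[of abs] cong: if_cong)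
  have "norm (x * y) \<le> (\<Sum>S\<in>?G. \<Sum>T\<in>?G. \<bar>coef x T\<bar> * \<bar>coef y (symd T S)\<bar>)"
    unfolding norm_clifford_def times_clifford.rep_eq
    by (rule sum_mono, rule order_trans[OF sum_abs]) (simp add: abs_mult)
  also have "\<dots> = (\<Sum>T\<in>?G. \<Sum>S\<in>?G. \<bar>coef x T\<bar> * \<bar>coef y (symd T S)\<bar>)"
    by (rule sum.swap)
  also have "\<dots> = (\<Sum>T\<in>?G. \<bar>coef x T\<bar> * norm y)"
  proof (rule sum.cong[OF refl])
    fix T assume T: "T \<in> ?G"
    have "(\<Sum>S\<in>?G. \<bar>coef y (symd T S)\<bar>) = norm y"
      unfolding norm_clifford_def
      by (rule sum.reindex_bij_betw[OF bij_betw_symd]) (use T in auto)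
    then show "(\<Sum>S\<in>?G. \<bar>coef x T\<bar> * \<bar>coef y (symd T S)\<bar>) = \<bar>coef x T\<bar> * norm y"
      by (simp add: sum_distrib_left[symmetric])
  qed
  also have "\<dots> = norm x * norm y"
    by (simp add: norm_clifford_def sum_distrib_right)
  finally show "norm (x * y) \<le> norm x * norm y" .
qed (simp_all add: dist_clifford_def sgn_clifford_def uniformity_clifford_def open_clifford_def,
    (rule clifford_eqI; simp add: plus_clifford.rep_eq scaleR_clifford.rep_eq times_clifford.rep_eq
      algebra_simps sum_distrib_left)+)

end

lemma abs_coef_le_norm: "\<bar>coef (x :: 's::signature clifford) S\<bar> \<le> norm x"
proof (cases "S \<subseteq> gens TYPE('s)")
  case True
  then show ?thesis
    unfolding norm_clifford_def by (intro member_le_sum) auto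
qed (simp add: coef_outside)

instance clifford :: (signature) banach
proof
  fix X :: "nat \<Rightarrow> 'a clifford"
  assume X: "Cauchy X"
  let ?G = "Pow (gens TYPE('a))"
  have "Cauchy (\<lambda>n. coef (X n) S)" for S
  proof (rule metric_CauchyI)
    fix e :: real assume "0 < e"
    then obtain M where M: "\<And>m n. m \<ge> M \<Longrightarrow> n \<ge> M \<Longrightarrow> dist (X m) (X n) < e"
      using metric_CauchyD[OF X] by blast
    have "dist (coef (X m) S) (coef (X n) S) \<le> dist (X m) (X n)" for m n
      using abs_coef_le_norm[of "X m - X n" S]
      by (simp add: dist_norm minus_clifford.rep_eq)
    then show "\<exists>M. \<forall>m\<ge>M. \<forall>n\<ge>M. dist (coef (X m) S) (coef (X n) S) < e"
      using M by (meson le_less_trans)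
  qed
  then have lim: "(\<lambda>n. coef (X n) S) \<longlonglongrightarrow> lim (\<lambda>n. coef (X n) S)" for S
    by (simp add: Cauchy_convergent_iff convergent_LIMSEQ_iff)
  define L :: "'a clifford" where "L = Abs_clifford (\<lambda>S. lim (\<lambda>n. coef (X n) S))"
  have L: "coef L S = lim (\<lambda>n. coef (X n) S)" for S
    unfolding L_def by (subst Abs_clifford_inverse) (auto simp: coef_outside)
  have "(\<lambda>n. norm (X n - L)) \<longlonglongrightarrow> (\<Sum>S\<in>?G. \<bar>coef L S - coef L S\<bar>)"
    unfolding norm_clifford_def minus_clifford.rep_eq
    by (intro tendsto_intros) (use lim L in auto)
  then have "X \<longlonglongrightarrow> L"
    by (simp add: LIM_zero_iff tendsto_norm_zero_iff)
  then show "convergent X"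
    by (auto simp: convergent_def)
qed


section \<open>Generators, blades and grades\<close>

lift_definition blade :: "nat set \<Rightarrow> 's::signature clifford"
  is "\<lambda>S T. if T = S \<and> S \<subseteq> gens TYPE('s) then 1 else 0" by auto

definition gen :: "nat \<Rightarrow> 's::signature clifford" where
  "gen i = blade {i}"

lemma blade_mult:
  assumes "S \<subseteq> gens TYPE('s::signature)" "T \<subseteq> gens TYPE('s)"
  shows "blade S * blade T = blade_sign TYPE('s) S T *\<^sub>R (blade (symd S T) :: 's clifford)"
proof (rule clifford_eqI)
  fix R assume R: "R \<subseteq> gens TYPE('s)"
  have eq: "symd S R = T \<longleftrightarrow> R = symd S T"
    by (metis symd_cancel)
  have "coef (blade S * blade T :: 's clifford) R =
      (\<Sum>U\<in>Pow (gens TYPE('s)). if U = S then (if symd S R = T then blade_sign TYPE('s) S T else 0) else 0)"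
    unfolding times_clifford.rep_eq blade.rep_eq using assms by (intro sum.cong) auto
  also have "\<dots> = (if R = symd S T then blade_sign TYPE('s) S T else 0)"
    using assms by (simp add: eq)
  finally show "coef (blade S * blade T :: 's clifford) R =
      coef (blade_sign TYPE('s) S T *\<^sub>R (blade (symd S T) :: 's clifford)) R"
    using assms by (simp add: scaleR_clifford.rep_eq blade.rep_eq)
qed

lemma blade_empty: "blade {} = (1 :: 's::signature clifford)"
  by (rule clifford_eqI) (simp add: blade.rep_eq one_clifford.rep_eq)

lemma gen_mult_gen:
  assumes "i \<in> gens TYPE('s::signature)"
  shows "gen i * gen i = (of_real (gen_sq TYPE('s) i) :: 's clifford)"
  using assms
  by (simp add: gen_def blade_mult blade_sign_def gen_swap_def blade_empty of_real_def)

lemma gen_anticommute: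
  assumes "i \<in> gens TYPE('s::signature)" "j \<in> gens TYPE('s)" "i \<noteq> j"
  shows "gen i * gen j = - (gen j * gen i :: 's clifford)"
proof -
  have "symd {i} {j} = symd {j} {i}"
    by (rule symd_commute)
  with assms show ?thesis
    by (cases i j rule: linorder_cases)
      (simp_all add: gen_def blade_mult blade_sign_def gen_swap_def)
qed

lemma blade_insert:
  assumes "i \<in> gens TYPE('s::signature)" "S \<subseteq> gens TYPE('s)" "\<And>j. j \<in> S \<Longrightarrow> i < j"
  shows "blade (insert i S) = gen i * (blade S :: 's clifford)"
proof -
  have "symd {i} S = insert i S"
    using assms(3) by (auto simp: symd_def)
  moreover have "gen_swap TYPE('s) i j = 1" if "j \<in> S" for j
    using assms(3)[OF that] by (simp add: gen_swap_def)
  then have "blade_sign TYPE('s) {i} S = 1"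
    by (simp add: blade_sign_def)
  ultimately show ?thesis
    using assms by (simp add: gen_def blade_mult)
qed

lemma coef_sum: "coef (\<Sum>i\<in>I. f i) S = (\<Sum>i\<in>I. coef (f i :: 's::signature clifford) S)"
  by (induction I rule: infinite_finite_induct)
    (simp_all add: zero_clifford.rep_eq plus_clifford.rep_eq)

lemma blade_expansion:
  "x = (\<Sum>S\<in>Pow (gens TYPE('s)). coef x S *\<^sub>R (blade S :: 's::signature clifford))"
proof (rule clifford_eqI)
  fix T assume T: "T \<subseteq> gens TYPE('s)"
  have "coef (\<Sum>S\<in>Pow (gens TYPE('s)). coef x S *\<^sub>R (blade S :: 's clifford)) T =
      (\<Sum>S\<in>Pow (gens TYPE('s)). if S = T then coef x T else 0)"
    unfolding coef_sum scaleR_clifford.rep_eq blade.rep_eq by (intro sum.cong) auto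
  also have "\<dots> = coef x T"
    using T by (simp add: sum.delta)
  finally show "coef x T = coef (\<Sum>S\<in>Pow (gens TYPE('s)). coef x S *\<^sub>R (blade S :: 's clifford)) T" ..
qed

lift_definition grade_part :: "nat \<Rightarrow> 's::signature clifford \<Rightarrow> 's clifford"
  is "\<lambda>k x S. if card S = k then x S else 0" by auto

definition scalar_part :: "'s::signature clifford \<Rightarrow> real" where
  "scalar_part x = coef x {}"


section \<open>The ingredients of the logarithm formula in dimension three\<close>

definition pss :: "'s::signature clifford" where
  "pss = gen 1 * gen 2 * gen 3"

text \<open>Outer product of a vector and a bivector.\<close>

definition wedge12 :: "'s::signature clifford \<Rightarrow> 's clifford \<Rightarrow> 's clifford" where
  "wedge12 a B = grade_part 3 (a * B)"

text \<open>In dimension three the square of a vector, of a bivector and of a pseudoscalar, as well as a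
  product of two pseudoscalars, is a real multiple of \<open>1\<close>; \<^const>\<open>scalar_part\<close> only turns it
  into an element of \<^typ>\<open>real\<close>.\<close>

definition dots :: "'s::signature clifford \<Rightarrow> 's clifford \<Rightarrow> real" where
  "dots a B = scalar_part (a * a) + scalar_part (B * B)"

definition disc :: "'s::signature clifford \<Rightarrow> 's clifford \<Rightarrow> real" where
  "disc a B = (dots a B)\<^sup>2 - 4 * scalar_part ((wedge12 a B)\<^sup>2)"

definition a_plus :: "'s::signature clifford \<Rightarrow> 's clifford \<Rightarrow> real" where
  "a_plus a B =
    (if wedge12 a B \<noteq> 0 then sqrt (dots a B + sqrt (disc a B)) / sqrt 2
     else if dots a B \<ge> 0 then sqrt (dots a B)
     else 0)"

definition a_minus :: "'s::signature clifford \<Rightarrow> 's clifford \<Rightarrow> real" where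
  "a_minus a B =
    (if wedge12 a B \<noteq> 0
     then - 2 * scalar_part (pss * wedge12 a B) / (sqrt 2 * sqrt (dots a B + sqrt (disc a B)))
     else if dots a B \<ge> 0 then 0
     else sqrt (- dots a B))"

text \<open>The abscissa is the first argument.  \<^const>\<open>Arg\<close> takes values in \<open>(-\<pi>, \<pi>]\<close>.\<close>

definition arctan2 :: "real \<Rightarrow> real \<Rightarrow> real" where
  "arctan2 x y = Arg (Complex x y)"

lemma arctan2_iff:
  assumes "(x, y) \<noteq> (0, 0)"
  shows "arctan2 x y = t \<longleftrightarrow>
    - pi < t \<and> t \<le> pi \<and> cos t = x / sqrt (x\<^sup>2 + y\<^sup>2) \<and> sin t = y / sqrt (x\<^sup>2 + y\<^sup>2)"
proof -
  let ?z = "Complex x y"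
  have nz: "?z \<noteq> 0"
    using assms by (auto simp: complex_eq_iff)
  have "sgn ?z = cis t \<longleftrightarrow> cos t = x / sqrt (x\<^sup>2 + y\<^sup>2) \<and> sin t = y / sqrt (x\<^sup>2 + y\<^sup>2)"
    by (auto simp: complex_eq_iff Re_sgn Im_sgn cmod_def)
  then show ?thesis
    unfolding arctan2_def
    using Arg_correct[OF nz] cis_Arg_unique[of ?z t] by auto
qed

end

theory Submission
  imports Defs
begin

text \<open>In both signatures the pseudoscalar \<open>I\<close> is central with \<open>I\<^sup>2 = -1\<close>, so scalars and
  pseudoscalars together form a central copy of the complex numbers and the algebra is a complex
  one.  Write \<open>F\<close> for the sum of the vector and the bivector part of the multivector \<open>A\<close>.  The
  squares of a vector \<open>a\<close> and a bivector \<open>B\<close> are real and \<open>a B + B a\<close> is a pseudoscalar, hence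
  \<open>F\<^sup>2\<close> is a complex number in this sense, and the formulas for \<open>a\<^sub>+\<close> and \<open>a\<^sub>-\<close> say precisely that
  \<open>z = a\<^sub>+ + a\<^sub>- I\<close> is a square root of it (lemmas \<open>square_vector_plus_bivector\<close> and
  \<open>a_plus_minus_square\<close>).

  If \<open>z \<noteq> 0\<close>, then \<open>U = F / z\<close> satisfies \<open>U\<^sup>2 = 1\<close>, and with \<open>\<alpha> = a\<^sub>0 + a\<^sub>1\<^sub>2\<^sub>3 I\<close> we have
  \<open>A = \<alpha> + z U\<close>.  The idempotents \<open>(1 \<plusminus> U) / 2\<close> make \<open>x + y U\<close> behave like the pair of complex
  numbers \<open>(x + y, x - y)\<close>, so that \<open>exp\<close> acts on the two components separately (lemma
  \<open>exp_spectral\<close>).  A logarithm of \<open>A\<close> is thus given by a complex logarithm of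
  \<open>p = \<alpha> + z\<close>, whose modulus is \<open>k\<^sub>+\<close>, and one of \<open>q = \<alpha> - z\<close>, whose modulus is \<open>k\<^sub>-\<close>.

  The two components of the claimed logarithm have the right real parts \<open>ln k\<^sub>+\<close> and \<open>ln k\<^sub>-\<close>, and
  modulo \<open>2 \<pi>\<close> their imaginary parts are \<open>\<theta> - \<psi> / 2\<close> and \<open>\<theta> + \<psi> / 2\<close>, where \<open>\<theta>\<close> and \<open>\<psi>\<close> are
  the two arc tangents of the formula.  Here \<open>\<psi>\<close> is the angle from \<open>p\<close> to \<open>q\<close> and \<open>\<theta>\<close> is the
  argument of \<open>k\<^sub>- p + k\<^sub>+ q\<close>, the direction that bisects this angle; genericity says that the two
  directions are not opposite.  That these are arguments of \<open>p\<close> and \<open>q\<close> is elementary geometry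
  in the complex plane (lemma \<open>exp_half_angle\<close>).\<close>


section \<open>Complex numbers inside a real algebra\<close>

definition cplx :: "'a::real_algebra_1 \<Rightarrow> complex \<Rightarrow> 'a" where
  "cplx J w = of_real (Re w) + Im w *\<^sub>R J"

lemma cplx_add: "cplx J (v + w) = cplx J v + cplx J w"
  by (simp add: cplx_def algebra_simps)

lemma cplx_diff: "cplx J (v - w) = cplx J v - cplx J w"
  by (simp add: cplx_def algebra_simps)

lemma cplx_scaleR: "cplx J (r *\<^sub>R w) = r *\<^sub>R cplx J w"
  by (simp add: cplx_def of_real_def scaleR_add_right)

lemma cplx_1: "cplx J 1 = 1"
  by (simp add: cplx_def)

lemma cplx_mult:
  assumes "J * J = - 1"
  shows "cplx J (v * w) = cplx J v * cplx J w"
  by (simp add: cplx_def of_real_def algebra_simps assms)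

lemma cplx_commute:
  assumes "U * J = J * U"
  shows "U * cplx J w = cplx J w * U"
  by (simp add: cplx_def of_real_def algebra_simps assms)

lemma bounded_linear_cplx:
  "bounded_linear (cplx (J :: 'a::real_normed_algebra_1))"
  unfolding cplx_def of_real_def
  by (intro bounded_linear_add bounded_linear_scaleR_const bounded_linear_Re bounded_linear_Im)


section \<open>The exponential of x + y U for an involution U\<close>

text \<open>The element that is multiplication by \<open>s\<close> on the range of the idempotent \<open>(1 + U) / 2\<close>
  and by \<open>t\<close> on the range of \<open>(1 - U) / 2\<close>.  In the form \<open>x + y U\<close> it has \<open>x = (s + t) / 2\<close> and
  \<open>y = (s - t) / 2\<close>, which is how the logarithm formula presents it.\<close>

definition spectral :: "'a::real_algebra_1 \<Rightarrow> 'a \<Rightarrow> complex \<Rightarrow> complex \<Rightarrow> 'a" where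
  "spectral J U s t = cplx J ((s + t) / 2) + cplx J ((s - t) / 2) * U"

text \<open>The two idempotents are orthogonal, so products can be taken component by component.\<close>

lemma spectral_mult:
  assumes J: "J * J = - 1" and U: "U * U = 1" "U * J = J * U"
  shows "spectral J U s t * spectral J U s' t' = spectral J U (s * s') (t * t')"
proof -
  let ?c = "cplx J"
  have comm: "U * (?c v * x) = ?c v * (U * x)" for v x
    by (metis cplx_commute[OF U(2)] mult.assoc)
  have "(?c v + ?c w * U) * (?c v' + ?c w' * U) = ?c (v * v' + w * w') + ?c (v * w' + w * v') * U"
    for v w v' w'
    by (simp add: cplx_mult[OF J] cplx_add distrib_left distrib_right mult.assoc comm
        cplx_commute[OF U(2)] U(1) add_ac)
  moreover have "(s + t) / 2 * ((s' + t') / 2) + (s - t) / 2 * ((s' - t') / 2) = (s * s' + t * t') / 2"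
    and "(s + t) / 2 * ((s' - t') / 2) + (s - t) / 2 * ((s' + t') / 2) = (s * s' - t * t') / 2"
    by (simp_all add: field_simps)
  ultimately show ?thesis
    by (simp only: spectral_def)
qed

lemma spectral_power:
  assumes "J * J = - 1" "U * U = 1" "U * J = J * U"
  shows "spectral J U s t ^ n = spectral J U (s ^ n) (t ^ n)"
  by (induction n) (simp_all add: spectral_mult[OF assms], simp add: spectral_def cplx_1 cplx_def)

text \<open>Powers are taken component by component, and the result depends linearly and continuously on
  the two components, so the exponential series may be summed in the complex numbers.\<close>

lemma exp_spectral:
  fixes J U :: "'a::{real_normed_algebra_1,banach}"
  assumes "J * J = - 1" "U * U = 1" "U * J = J * U"
  shows "exp (spectral J U s t) = spectral J U (exp s) (exp t)"
proof -
  have lin: "(\<lambda>n. f (v ^ n /\<^sub>R fact n)) sums f (exp v)" if "bounded_linear f"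
    for f :: "complex \<Rightarrow> 'a" and v
    by (rule bounded_linear.sums[OF that exp_converges])
  define P where "P = (1 + U) /\<^sub>R 2"
  define Q where "Q = (1 - U) /\<^sub>R 2"
  have half: "cplx J (w / 2) = cplx J w /\<^sub>R 2" for w
    using cplx_scaleR[of J "inverse 2" w] by (simp add: scaleR_conv_of_real field_simps)
  have dec: "spectral J U v w = cplx J v * P + cplx J w * Q" for v w
    unfolding spectral_def half P_def Q_def cplx_add cplx_diff
    by (simp add: algebra_simps)
  have "bounded_linear (\<lambda>w. cplx J w * R)" for R
    by (rule bounded_linear_compose[OF bounded_linear_mult_left bounded_linear_cplx])
  then have "(\<lambda>n. cplx J (s ^ n /\<^sub>R fact n) * P + cplx J (t ^ n /\<^sub>R fact n) * Q)
      sums spectral J U (exp s) (exp t)"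
    unfolding dec by (intro sums_add lin)
  moreover have "cplx J (s ^ n /\<^sub>R fact n) * P + cplx J (t ^ n /\<^sub>R fact n) * Q =
      spectral J U s t ^ n /\<^sub>R fact n" for n
    unfolding spectral_power[OF assms] unfolding dec cplx_scaleR by (simp add: scaleR_add_right)
  ultimately show ?thesis
    using sums_unique2[OF exp_converges] by simp
qed


section \<open>Two complex arguments from their bisector and their difference\<close>

text \<open>With \<open>\<psi>\<close> the angle from \<open>p\<close> to \<open>q\<close>, the vectors \<open>|q| p\<close> and \<open>|p| q\<close> have equal length, so
  their sum points along the bisector \<open>p exp (\<i> \<psi> / 2)\<close> or opposite to it.  Since \<open>\<psi>\<close> is chosen
  in \<open>(-\<pi>, \<pi>]\<close> and the sum does not vanish, \<open>cos (\<psi> / 2) > 0\<close> and the first case holds.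
  Turning the bisector by half the angle in either direction gives back \<open>p\<close> and \<open>q\<close>.\<close>

lemma exp_half_angle:
  fixes p q :: complex
  assumes p: "p \<noteq> 0" and q: "q \<noteq> 0" and s: "cmod q * p + cmod p * q \<noteq> 0"
  defines "\<theta> \<equiv> Arg (cmod q * p + cmod p * q)" and "\<psi> \<equiv> Arg (q * cnj p)"
  shows "exp (Complex (ln (cmod p)) (\<theta> - \<psi> / 2)) = p"
    and "exp (Complex (ln (cmod q)) (\<theta> + \<psi> / 2)) = q"
proof -
  have \<psi>: "- pi < \<psi>" "\<psi> \<le> pi" and "sgn (q * cnj p) = cis \<psi>"
    using Arg_correct[of "q * cnj p"] p q by (auto simp: \<psi>_def)
  then have "q * cnj p = cmod p * cmod q * cis \<psi>"
    using p q by (simp add: sgn_eq norm_mult field_simps)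
  then have "q * (cnj p * p) = cmod p * cmod q * cis \<psi> * p"
    by (metis mult.assoc)
  then have "cmod p * (cmod p * q) = cmod p * (cmod q * p * cis \<psi>)"
    using complex_norm_square[of p] by (simp add: power2_eq_square mult_ac)
  then have qp: "cmod p * q = cmod q * p * cis \<psi>"
    using p by simp
  have cis2: "cis \<psi> = cis (\<psi> / 2) * cis (\<psi> / 2)"
    by (simp add: cis_mult)
  have cis1: "1 = cis (\<psi> / 2) * cis (- (\<psi> / 2))"
    by (simp add: cis_mult)
  have "cis (\<psi> / 2) + cis (- (\<psi> / 2)) = 2 * cos (\<psi> / 2)"
    by (simp add: complex_eq_iff)
  then have fac: "1 + cis \<psi> = cis (\<psi> / 2) * (2 * cos (\<psi> / 2))"
    by (metis cis1 cis2 distrib_left add.commute)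
  then have sum: "cmod q * p + cmod p * q = (2 * cos (\<psi> / 2) * cmod q) * (p * cis (\<psi> / 2))"
  proof -
    have "cmod q * p + cmod p * q = cmod q * p * (1 + cis \<psi>)"
      unfolding qp by (simp add: distrib_left)
    then show ?thesis
      unfolding fac by (simp add: mult_ac)
  qed
  have "\<psi> \<noteq> pi"
    using s sum by auto
  with \<psi> have cos: "cos (\<psi> / 2) > 0"
    by (intro cos_gt_zero_pi) auto
  then have "sgn (cmod q * p + cmod p * q) = p * cis (\<psi> / 2) / cmod p"
    unfolding sum using p q by (simp add: sgn_eq norm_mult field_simps)
  then have \<theta>: "cis \<theta> = p * cis (\<psi> / 2) / cmod p"
    using Arg_correct[OF s] by (simp add: \<theta>_def)
  have "cis (\<theta> - \<psi> / 2) = p / cmod p"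
    by (simp add: cis_divide[symmetric] \<theta>)
  then show "exp (Complex (ln (cmod p)) (\<theta> - \<psi> / 2)) = p"
    using p by (simp add: exp_eq_polar exp_of_real[symmetric])
  have "cis (\<theta> + \<psi> / 2) = p * cis \<psi> / cmod p"
    by (simp add: cis_mult[symmetric] \<theta> cis2)
  also have "\<dots> = q / cmod q"
    using qp p q by (simp add: field_simps)
  finally show "exp (Complex (ln (cmod q)) (\<theta> + \<psi> / 2)) = q"
    using q by (simp add: exp_eq_polar exp_of_real[symmetric])
qed

lemma exp_Complex_add_2pi:
  "exp (Complex x (y + 2 * pi * of_int k)) = exp (Complex x y)"
  by (simp add: exp_eq_polar cis_mult[symmetric] cis_multiple_2pi)


section \<open>The square of a vector plus a bivector\<close>

lemma parts_linear:
  "scalar_part (x + y) = scalar_part x + scalar_part y"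
  "scalar_part (x - y) = scalar_part x - scalar_part y"
  "scalar_part (- x) = - scalar_part x"
  "scalar_part (r *\<^sub>R x) = r * scalar_part x"
  "scalar_part (1 :: 's::signature clifford) = 1"
  "grade_part k (x + y) = grade_part k x + grade_part k y"
  "grade_part k (- x) = - grade_part k x"
  "grade_part k (r *\<^sub>R x) = r *\<^sub>R grade_part k x"
  for x y :: "'s::signature clifford"
  by (simp_all add: scalar_part_def plus_clifford.rep_eq minus_clifford.rep_eq uminus_clifford.rep_eq
      scaleR_clifford.rep_eq one_clifford.rep_eq)
    (transfer; auto)+

lemma grade_part_blade: "grade_part k (blade S) = (if card S = k then blade S else 0)"
  by transfer auto

context
  fixes a B :: "'s::signature clifford" and a1 a2 a3 a12 a13 a23 :: real
  assumes sig: "(pos_dim TYPE('s), neg_dim TYPE('s)) \<in> {(3, 0), (1, 2)}"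
  defines "a \<equiv> a1 *\<^sub>R gen 1 + a2 *\<^sub>R gen 2 + a3 *\<^sub>R gen 3"
    and "B \<equiv> a12 *\<^sub>R (gen 1 * gen 2) + a13 *\<^sub>R (gen 1 * gen 3) + a23 *\<^sub>R (gen 2 * gen 3)"
begin

(* The index of the first generator has to stay a numeral for the rewrite rules below to match. *)
declare One_nat_def [simp del]

lemma gens3: "gens TYPE('s) = {1, 2, 3}"
  using sig by (auto simp: gens_def)

text \<open>In both signatures \<open>e\<^sub>1\<^sup>2 = 1\<close> and \<open>e\<^sub>2\<^sup>2 = e\<^sub>3\<^sup>2\<close>.  Hence \<open>e\<^sub>1\<^sup>2 e\<^sub>2\<^sup>2 e\<^sub>3\<^sup>2 = 1\<close>, which is what makes
  the pseudoscalar square to \<open>-1\<close>.\<close>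

lemma gen_sq3:
  obtains g :: real where "gen_sq TYPE('s) 1 = 1" "gen_sq TYPE('s) 2 = g" "gen_sq TYPE('s) 3 = g"
    "g * g = 1"
  using sig by (auto simp: gen_sq_def)

lemma gen_swaps:
  "gen 2 * gen 1 = - (gen 1 * gen 2 :: 's clifford)"
  "gen 3 * gen 1 = - (gen 1 * gen 3 :: 's clifford)"
  "gen 3 * gen 2 = - (gen 2 * gen 3 :: 's clifford)"
  by (rule gen_anticommute; simp add: gens3)+

lemma gen_squares:
  "gen 1 * gen 1 = (gen_sq TYPE('s) 1 *\<^sub>R 1 :: 's clifford)"
  "gen 2 * gen 2 = (gen_sq TYPE('s) 2 *\<^sub>R 1 :: 's clifford)"
  "gen 3 * gen 3 = (gen_sq TYPE('s) 3 *\<^sub>R 1 :: 's clifford)"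
  by (subst gen_mult_gen; simp add: gens3 of_real_def)+

text \<open>Products are normalised by association to the right, sorting of generators and cancellation
  of squares.  After association to the right two adjacent generators need not form a subterm, so
  that each rule is also required with a further factor behind it.\<close>

lemma mult_eq_extend:
  fixes x y z w :: "'b::semigroup_mult"
  shows "x * y = w \<Longrightarrow> x * (y * z) = w * z"
  by (metis mult.assoc)

lemmas gen_normalise = gen_swaps gen_squares gen_swaps[THEN mult_eq_extend] gen_squares[THEN mult_eq_extend]
  mult.assoc distrib_left distrib_right

lemma pss_sq: "pss * pss = (- 1 :: 's clifford)"
  by (rule gen_sq3) (simp add: pss_def gen_normalise)

lemma pss_commute: "(a + B) * pss = pss * (a + B)"
  by (rule gen_sq3) (simp add: pss_def a_def B_def gen_normalise algebra_simps)

lemma pss_blade: "pss = (blade {1, 2, 3} :: 's clifford)"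
proof -
  have "blade {1, 2, 3} = gen 1 * (blade {2, 3} :: 's clifford)"
    by (rule blade_insert) (auto simp: gens3)
  also have "blade {2, 3} = gen 2 * (blade {3} :: 's clifford)"
    by (rule blade_insert) (auto simp: gens3)
  finally show ?thesis
    by (simp add: pss_def gen_def mult.assoc)
qed

lemma grade_part_3:
  "grade_part 3 (gen i :: 's clifford) = 0"
  "grade_part 3 (pss :: 's clifford) = pss"
  by (simp_all add: gen_def pss_blade grade_part_blade)

text \<open>The coefficient of the pseudoscalar in \<open>a B\<close>: if \<open>B\<close> is the outer product of
  two vectors \<open>u\<close> and \<open>v\<close>, it is the determinant of the coordinates of \<open>a\<close>, \<open>u\<close> and \<open>v\<close>.\<close>

definition triple :: real where "triple = a1 * a23 - a2 * a13 + a3 * a12"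

text \<open>Exchanging a vector and a bivector negates the grade-1 part of their product and keeps the
  grade-3 part; therefore only the pseudoscalar survives in \<open>a B + B a\<close>.\<close>

lemma vector_times_bivector:
  obtains v1 v2 v3 :: real where
  "a * B = v1 *\<^sub>R gen 1 + v2 *\<^sub>R gen 2 + v3 *\<^sub>R gen 3 + triple *\<^sub>R pss"
  "B * a = - (v1 *\<^sub>R gen 1 + v2 *\<^sub>R gen 2 + v3 *\<^sub>R gen 3) + triple *\<^sub>R pss"
proof -
  let ?g = "gen_sq TYPE('s)"
  show thesis
    by (rule that[of "- ?g 2 * a2 * a12 - ?g 3 * a3 * a13" "?g 1 * a1 * a12 - ?g 3 * a3 * a23"
          "?g 1 * a1 * a13 + ?g 2 * a2 * a23"])
      (simp_all add: a_def B_def pss_def triple_def gen_normalise scaleR_add_left scaleR_diff_left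
        scaleR_add_right scaleR_diff_right algebra_simps)
qed

lemma wedge12_eq_triple: "wedge12 a B = triple *\<^sub>R pss"
  by (rule vector_times_bivector) (simp add: wedge12_def parts_linear grade_part_3)

lemma vector_sq: "a * a = scalar_part (a * a) *\<^sub>R 1"
  by (simp add: a_def gen_normalise parts_linear algebra_simps)

lemma bivector_sq: "B * B = scalar_part (B * B) *\<^sub>R 1"
  by (simp add: B_def gen_normalise parts_linear algebra_simps)

lemma square_vector_plus_bivector: "(a + B) * (a + B) = cplx pss (Complex (dots a B) (2 * triple))"
proof -
  have "a * B + B * a = (2 * triple) *\<^sub>R pss"
    by (rule vector_times_bivector) (simp add: scaleR_add_left[symmetric])
  then show ?thesis
    using vector_sq bivector_sq by (simp add: cplx_def dots_def of_real_def algebra_simps)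
qed

text \<open>With \<open>\<bar>F\<^sup>2\<bar> = sqrt (disc a B)\<close> this is the usual formula for the complex square root in
  terms of real and imaginary part and modulus.  It obtains the imaginary part by division
  by the real part \<open>a\<^sub>+\<close>, which is zero when \<open>F\<^sup>2\<close> is a negative real number; real values of
  \<open>F\<^sup>2\<close> are therefore a case of their own.\<close>

lemma a_plus_minus_square: "(Complex (a_plus a B) (a_minus a B))\<^sup>2 = Complex (dots a B) (2 * triple)"
proof -
  let ?d = "dots a B" and ?p = triple
  have w: "wedge12 a B = 0 \<longleftrightarrow> ?p = 0"
    using pss_sq by (auto simp: wedge12_eq_triple)
  have s1: "scalar_part (pss * wedge12 a B) = - ?p"
    by (simp add: wedge12_eq_triple pss_sq parts_linear)
  have disc: "disc a B = ?d\<^sup>2 + (2 * ?p)\<^sup>2"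
    by (simp add: disc_def wedge12_eq_triple power2_eq_square pss_sq parts_linear)
  show ?thesis
  proof (cases "?p = 0")
    case True
    then show ?thesis
      using w by (auto simp: a_plus_def a_minus_def complex_eq_iff power2_eq_square)
  next
    case False
    define r where "r = sqrt (disc a B)"
    define t where "t = sqrt (?d + r)"
    \<comment> \<open>The modulus strictly exceeds the real part in size, so \<open>a\<^sub>+\<close> is positive.\<close>
    have "sqrt (?d\<^sup>2) < r"
      unfolding r_def disc using False by (intro real_sqrt_less_mono) simp
    then have pos: "?d + r > 0" and r: "r * r = ?d * ?d + 4 * ?p * ?p"
      using disc by (auto simp: r_def power2_eq_square)
    then have t: "t > 0" "t * t = ?d + r"
      by (auto simp: t_def)
    have ap: "a_plus a B = t / sqrt 2" and am: "a_minus a B = 2 * ?p / (sqrt 2 * t)"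
      using False w by (simp_all add: a_plus_def a_minus_def s1 t_def r_def)
    have "a_plus a B * a_plus a B = (?d + r) / 2" "a_plus a B * a_minus a B = ?p"
      using t by (simp_all add: ap am)
    moreover have "a_minus a B * a_minus a B = (r - ?d) / 2"
    proof -
      have "2 * ?p * ?p = (r - ?d) / 2 * (?d + r)"
        using r by (simp add: field_simps)
      moreover have "a_minus a B * a_minus a B = 2 * ?p * ?p / (?d + r)"
        using t by (simp add: am power2_eq_square field_simps)
      ultimately show ?thesis
        using pos by simp
    qed
    ultimately show ?thesis
      by (simp add: complex_eq_iff power2_eq_square field_simps)
  qed
qed

end

section \<open>The logarithm formula\<close>

theorem theorem4p1:
  fixes A a B I A0 A12_log A12_arctan AI :: "'s::signature clifford"
    and a0 a1 a2 a3 a12 a13 a23 a123 ap am kp km :: real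
    and c1 c2 :: int
  assumes "(pos_dim TYPE('s), neg_dim TYPE('s)) \<in> {(3, 0), (1, 2)}"
    and "I = pss"
    and "a = a1 *\<^sub>R gen 1 + a2 *\<^sub>R gen 2 + a3 *\<^sub>R gen 3"
    and "B = a12 *\<^sub>R (gen 1 * gen 2) + a13 *\<^sub>R (gen 1 * gen 3) + a23 *\<^sub>R (gen 2 * gen 3)"
    and "A = of_real a0 + a + B + a123 *\<^sub>R I"
    and "ap = a_plus a B" and "am = a_minus a B"
    and "km \<ge> 0" and "km\<^sup>2 = (ap - a0)\<^sup>2 + (am - a123)\<^sup>2"
    and "kp \<ge> 0" and "kp\<^sup>2 = (ap + a0)\<^sup>2 + (am + a123)\<^sup>2"
    and "ap\<^sup>2 + am\<^sup>2 \<noteq> 0" and "km * kp \<noteq> 0"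
    and "(ap + a0) * km - (ap - a0) * kp \<noteq> 0 \<or> (am + a123) * km - (am - a123) * kp \<noteq> 0"
    and "A0 = of_real (1/2 * (ln kp + ln km))"
    and "A12_log =
      (1/2 * (ln kp - ln km)) *\<^sub>R (((of_real ap - am *\<^sub>R I) /\<^sub>R (am\<^sup>2 + ap\<^sup>2)) * (a + B))"
    and "A12_arctan =
      (1/2 * arctan2 (- (ap\<^sup>2 - a0\<^sup>2) - (am\<^sup>2 - a123\<^sup>2))
                     ((ap - a0) * (am + a123) - (ap + a0) * (am - a123)) + 2 * pi * of_int c1) *\<^sub>R
      (- I * ((of_real ap - am *\<^sub>R I) /\<^sub>R (am\<^sup>2 + ap\<^sup>2)) * (a + B))"
    and "AI =
      arctan2 ((ap + a0) * km - (ap - a0) * kp) ((am + a123) * km - (am - a123) * kp) *\<^sub>R I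
      + (2 * pi * of_int c2) *\<^sub>R I"
  shows "exp (A0 + A12_log + A12_arctan + AI) = A"
proof -
  define J where "J = (pss :: 's clifford)"
  define z where "z = Complex ap am"
  define \<alpha> where "\<alpha> = Complex a0 a123"
  define F where "F = a + B"
  define U where "U = cplx J (1 / z) * F"
  have J: "J * J = - 1"
    unfolding J_def by (rule pss_sq[OF assms(1)])
  have FJ: "F * J = J * F"
    unfolding F_def J_def assms(3,4) by (rule pss_commute[OF assms(1)])
  have FF: "F * F = cplx J (z\<^sup>2)"
    unfolding F_def J_def z_def assms(6,7) unfolding assms(3,4)
    unfolding a_plus_minus_square[OF assms(1)] by (rule square_vector_plus_bivector[OF assms(1)])
  have z0: "z \<noteq> 0"
    using assms(12) by (auto simp: z_def complex_eq_iff)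
  have UJ: "U * J = J * U"
    using FJ cplx_commute[of J J "1 / z"] by (simp add: U_def mult.assoc) (simp add: mult.assoc[symmetric])
  have UU: "U * U = 1"
  proof -
    have "U * U = cplx J (1 / z) * cplx J (1 / z) * (F * F)"
      unfolding U_def by (metis cplx_commute[OF FJ] mult.assoc)
    also have "\<dots> = cplx J (1 / z * (1 / z) * z\<^sup>2)"
      unfolding FF cplx_mult[OF J] ..
    also have "\<dots> = 1"
      using z0 by (simp add: power2_eq_square cplx_1)
    finally show ?thesis .
  qed
  have zU: "cplx J (z * w) * U = cplx J w * F" for w
    using z0 unfolding U_def mult.assoc[symmetric] cplx_mult[OF J, symmetric] by simp
  have "A = cplx J \<alpha> + cplx J z * U"
    using zU[of 1] by (simp add: assms(2,5) cplx_1 \<alpha>_def J_def cplx_def F_def)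
  then have A: "A = spectral J U (\<alpha> + z) (\<alpha> - z)"
    by (simp add: spectral_def)
  have kp: "kp = cmod (\<alpha> + z)" and km: "km = cmod (\<alpha> - z)"
    using assms(8-11) unfolding cmod_def
    by (simp_all add: \<alpha>_def z_def real_sqrt_unique add.commute power2_commute)
  define \<theta> where "\<theta> = Arg (cmod (\<alpha> - z) * (\<alpha> + z) + cmod (\<alpha> + z) * (\<alpha> - z))"
  define \<psi> where "\<psi> = Arg ((\<alpha> - z) * cnj (\<alpha> + z))"
  \<comment> \<open>The coefficient of \<open>U\<close> in the claimed logarithm contributes \<open>2 \<pi> c\<^sub>1\<close> with opposite signs
    to the two components, the coefficient of \<open>1\<close> contributes \<open>2 \<pi> c\<^sub>2\<close> to both.\<close>
  define s where "s = Complex (ln kp) (\<theta> - \<psi> / 2 + 2 * pi * of_int (c2 - c1))"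
  define t where "t = Complex (ln km) (\<theta> + \<psi> / 2 + 2 * pi * of_int (c2 + c1))"
  have \<theta>: "arctan2 ((ap + a0) * km - (ap - a0) * kp) ((am + a123) * km - (am - a123) * kp) = \<theta>"
    unfolding arctan2_def \<theta>_def kp[symmetric] km[symmetric]
    by (rule arg_cong[of _ _ Arg]) (simp add: complex_eq_iff \<alpha>_def z_def algebra_simps)
  have \<psi>: "arctan2 (- (ap\<^sup>2 - a0\<^sup>2) - (am\<^sup>2 - a123\<^sup>2))
      ((ap - a0) * (am + a123) - (ap + a0) * (am - a123)) = \<psi>"
    unfolding arctan2_def \<psi>_def
    by (rule arg_cong[of _ _ Arg])
      (simp add: complex_eq_iff \<alpha>_def z_def algebra_simps power2_eq_square)
  have ne: "\<alpha> + z \<noteq> 0" "\<alpha> - z \<noteq> 0"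
    using assms(13) kp km by auto
  have sum_ne: "cmod (\<alpha> - z) * (\<alpha> + z) + cmod (\<alpha> + z) * (\<alpha> - z) \<noteq> 0"
    using assms(14) unfolding kp[symmetric] km[symmetric]
    by (auto simp: complex_eq_iff \<alpha>_def z_def algebra_simps)
  have es: "exp s = \<alpha> + z" and et: "exp t = \<alpha> - z"
    unfolding s_def t_def exp_Complex_add_2pi
    using exp_half_angle[OF ne sum_ne] by (simp_all add: kp km \<theta>_def \<psi>_def)
  have inv: "(of_real ap - am *\<^sub>R I) /\<^sub>R (am\<^sup>2 + ap\<^sup>2) = cplx J (1 / z)"
  proof -
    have "1 / z = cnj z /\<^sub>R (am\<^sup>2 + ap\<^sup>2)"
      by (simp add: z_def complex_eq_iff Re_divide Im_divide field_simps)
    then show ?thesis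
      by (simp only: cplx_scaleR) (simp add: cplx_def z_def assms(2) J_def)
  qed
  have mean: "(s + t) / 2 = Complex (1 / 2 * (ln kp + ln km)) (\<theta> + 2 * pi * of_int c2)"
    and diff: "(s - t) / 2 = Complex (1 / 2 * (ln kp - ln km)) (- (1 / 2 * \<psi> + 2 * pi * of_int c1))"
    by (simp_all add: s_def t_def complex_eq_iff field_simps)
  have "A0 + A12_log + A12_arctan + AI = spectral J U s t"
    unfolding spectral_def mean diff assms(15-18) inv \<theta> \<psi> mult.assoc F_def[symmetric] U_def[symmetric]
    unfolding assms(2) J_def[symmetric]
    by (simp add: cplx_def of_real_def algebra_simps)
  then show ?thesis
    by (simp add: exp_spectral[OF J UU UJ] es et A)
qed

end
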